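(* Let $\lambda>0$ and $c>0$, and let $\eta(t)$ denote the hyperbolic distance from the origin $O$, at time $t\ge 0$, of the particle performing the random motion on the Poincaré half-plane described in the context. The mean value $E(t)=E\{\cosh\eta(t)\}$ satisfies the second-order linear homogeneous differential equation $$\frac{\mathrm d^2}{\mathrm dt^2}E(t)=-\lambda\frac{\mathrm d}{\mathrm dt}E(t)+c^2E(t),\qquad t>0,$$ with initial conditions $$E(0)=1,\qquad \left.\frac{\mathrm d}{\mathrm dt}E(t)\right|_{t=0}=0$$ (the derivative at $0$ being the right derivative). Explicitly, for $t\ge 0$, $$E(t)=e^{-\frac{\lambda t}{2}}\left\{\cosh\frac{t\sqrt{\lambda^2+4c^2}}{2}+\frac{\lambda}{\sqrt{\lambda^2+4c^2}}\sinh\frac{t\sqrt{\lambda^2+4c^2}}{2}\right\}.$$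
   Context: The motion takes place on the Poincaré upper half-plane $H_2^+=\{(x,y):y>0\}$ with metric $\mathrm ds^2=(\mathrm dx^2+\mathrm dy^2)/y^2$. A particle starts at the origin $O=(0,1)$ and moves with constant hyperbolic speed $c>0$ along geodesics, initially on the half-circumference with center $(0,0)$ and radius $1$. Changes of direction occur at the event times $0<T_1<T_2<\cdots$ of a homogeneous Poisson process $N(t)$ of rate $\lambda>0$: at time $T_n$ the particle is at a point $P_n$ and starts moving along the geodesic through $P_n$ orthogonal to the geodesic joining $O$ and $P_n$, in either of the two directions with probability $1/2$ each. By the hyperbolic Pythagorean theorem, the hyperbolic distance $\eta(t)\ge 0$ of the particle from $O$ at time $t$ is given, on $\{N(t)=n\}$ and with $T_0=0$, by $$\cosh\eta(t)=\cosh c(t-T_n)\prod_{k=1}^{n}\cosh c(T_k-T_{k-1}).$$ *)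

theory Defs
  imports "HOL-Probability.Probability"
begin

section \<open>The Poincare upper half-plane\<close>

definition half_plane :: "complex set" where
  "half_plane = {z. Im z > 0}"

text \<open>The Riemannian metric \<open>(dx\<^sup>2 + dy\<^sup>2) / y\<^sup>2\<close> on tangent vectors at \<open>z\<close>.\<close>

definition hyp_inner :: "complex \<Rightarrow> complex \<Rightarrow> complex \<Rightarrow> real" where
  "hyp_inner z v w = (v \<bullet> w) / (Im z)\<^sup>2"

definition hyp_norm :: "complex \<Rightarrow> complex \<Rightarrow> real" where
  "hyp_norm z v = sqrt (hyp_inner z v v)"

definition hyp_length :: "(real \<Rightarrow> complex) \<Rightarrow> real" where
  "hyp_length \<gamma> = integral {0..1} (\<lambda>s. hyp_norm (\<gamma> s) (vector_derivative \<gamma> (at s)))"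

text \<open>Only curves that are continuously differentiable up to the endpoints are admitted: the
  library's \<open>valid_path\<close> allows an unbounded derivative near a break point, and \<open>integral\<close> would
  assign length 0 to such a curve when it is not rectifiable.\<close>

definition hyp_dist :: "complex \<Rightarrow> complex \<Rightarrow> real" where
  "hyp_dist z w = Inf {hyp_length \<gamma> | \<gamma>. \<gamma> C1_differentiable_on {0..1} \<and>
     path_image \<gamma> \<subseteq> half_plane \<and> pathstart \<gamma> = z \<and> pathfinish \<gamma> = w}"

text \<open>Complete geodesics, parametrized by (signed) hyperbolic arc length. In the hyperbolic plane
  every geodesic is globally length-minimizing.\<close>

definition geodesic_line :: "(real \<Rightarrow> complex) \<Rightarrow> bool" where
  "geodesic_line \<gamma> \<longleftrightarrow> range \<gamma> \<subseteq> half_plane \<and> (\<forall>s t. hyp_dist (\<gamma> s) (\<gamma> t) = \<bar>s - t\<bar>)"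

text \<open>The origin \<open>O = (0, 1)\<close> is \<open>\<i>\<close>. The predicate below says that \<open>\<gamma>\<close> starts at \<open>P\<close> and is
  orthogonal there to the geodesic \<open>\<sigma>\<close> joining \<open>O\<close> and \<open>P\<close>; \<open>\<epsilon> = 1\<close> and \<open>\<epsilon> = -1\<close> select the two
  directions, to the left and to the right of the direction of \<open>\<sigma>\<close> as it leads away from \<open>O\<close>.\<close>

definition orthogonal_geodesic :: "complex \<Rightarrow> real \<Rightarrow> (real \<Rightarrow> complex) \<Rightarrow> bool" where
  "orthogonal_geodesic P \<epsilon> \<gamma> \<longleftrightarrow> geodesic_line \<gamma> \<and> \<gamma> 0 = P \<and>
     (\<exists>\<sigma> r v w. geodesic_line \<sigma> \<and> \<sigma> 0 = \<i> \<and> 0 < r \<and> \<sigma> r = P \<and>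
        (\<sigma> has_vector_derivative w) (at r) \<and> (\<gamma> has_vector_derivative v) (at 0) \<and>
        hyp_inner P w v = 0 \<and> sgn (Im (cnj w * v)) = \<epsilon>)"

text \<open>A trajectory \<open>x\<close> with speed \<open>c\<close>, changes of direction at the times \<open>T 1 < T 2 < \<dots>\<close>
  (\<open>T 0 = 0\<close> is the start), and direction \<open>\<epsilon> n\<close> chosen at time \<open>T n\<close>. The orientation of the
  initial motion along the unit half-circumference is left open.\<close>

definition trajectory ::
    "real \<Rightarrow> (nat \<Rightarrow> real) \<Rightarrow> (nat \<Rightarrow> real) \<Rightarrow> (real \<Rightarrow> complex) \<Rightarrow> bool" where
  "trajectory c T \<epsilon> x \<longleftrightarrow> (\<exists>\<gamma>.
     geodesic_line (\<gamma> 0) \<and> \<gamma> 0 0 = \<i> \<and> range (\<gamma> 0) \<subseteq> sphere 0 1 \<and>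
     (\<forall>n\<ge>1. orthogonal_geodesic (x (T n)) (\<epsilon> n) (\<gamma> n)) \<and>
     (\<forall>n. \<forall>t\<in>{T n..T (Suc n)}. x t = \<gamma> n (c * (t - T n))))"

section \<open>The random motion\<close>

definition event_count :: "(nat \<Rightarrow> 'a \<Rightarrow> real) \<Rightarrow> real \<Rightarrow> 'a \<Rightarrow> nat" where
  "event_count T t \<omega> = card {n. 1 \<le> n \<and> T n \<omega> \<le> t}"

text \<open>In \<open>independent_increments\<close> the sequence \<open>u\<close> is only weakly increasing, so finite partitions
  are included (as eventually constant sequences).\<close>

locale poisson_event_times = prob_space M for M :: "'a measure" +
  fixes rate :: real and T :: "nat \<Rightarrow> 'a \<Rightarrow> real"
  assumes rate_pos: "0 < rate"
    and T_measurable: "\<And>n. random_variable borel (T n)"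
    and T_0: "\<And>\<omega>. \<omega> \<in> space M \<Longrightarrow> T 0 \<omega> = 0"
    and T_less: "\<And>\<omega> n. \<omega> \<in> space M \<Longrightarrow> T n \<omega> < T (Suc n) \<omega>"
    and T_unbounded: "\<And>\<omega>. \<omega> \<in> space M \<Longrightarrow> filterlim (\<lambda>n. T n \<omega>) at_top sequentially"
    and poisson_increments: "\<And>s t. 0 \<le> s \<Longrightarrow> s < t \<Longrightarrow>
      distr M (count_space UNIV) (\<lambda>\<omega>. event_count T t \<omega> - event_count T s \<omega>)
        = measure_pmf (poisson_pmf (rate * (t - s)))"
    and independent_increments: "\<And>u :: nat \<Rightarrow> real. 0 \<le> u 0 \<Longrightarrow> mono u \<Longrightarrow>
      indep_vars (\<lambda>_. count_space UNIV)
        (\<lambda>i \<omega>. event_count T (u (Suc i)) \<omega> - event_count T (u i) \<omega>) UNIV"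

text \<open>\<open>D n\<close> (for \<open>n \<ge> 1\<close>) is the direction chosen at time \<open>T n\<close>, and \<open>X t\<close> is the position at
  time \<open>t \<ge> 0\<close>.\<close>

locale half_plane_motion = poisson_event_times M rate T
  for M :: "'a measure" and rate :: real and T :: "nat \<Rightarrow> 'a \<Rightarrow> real" +
  fixes c :: real and D :: "nat \<Rightarrow> 'a \<Rightarrow> real" and X :: "real \<Rightarrow> 'a \<Rightarrow> complex"
  assumes speed_pos: "0 < c"
    and D_values: "\<And>n \<omega>. 1 \<le> n \<Longrightarrow> \<omega> \<in> space M \<Longrightarrow> D n \<omega> \<in> {-1, 1}"
    and D_fair: "\<And>n. 1 \<le> n \<Longrightarrow> prob {\<omega> \<in> space M. D n \<omega> = 1} = 1 / 2"
    and D_indep: "indep_vars (\<lambda>_. borel) D {1..}"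
    and T_D_indep: "indep_var (PiM {1..} (\<lambda>_. borel)) (\<lambda>\<omega>. \<lambda>n\<in>{1..}. T n \<omega>)
                              (PiM {1..} (\<lambda>_. borel)) (\<lambda>\<omega>. \<lambda>n\<in>{1..}. D n \<omega>)"
    and motion: "\<And>\<omega>. \<omega> \<in> space M \<Longrightarrow>
      trajectory c (\<lambda>n. T n \<omega>) (\<lambda>n. D n \<omega>) (\<lambda>t. X t \<omega>)"

end

theory Submission
  imports Defs
begin

text \<open>In hyperboloid coordinates every geodesic line is \<open>cosh s \<cdot> G(0) + sinh s \<cdot> G'(0)\<close>, which
  yields the hyperbolic Pythagorean theorem and hence the product formula for \<open>cosh (\<eta> t)\<close>. Between
  events the pair of \<open>cosh (\<eta> t)\<close> and \<open>1/c\<close> times its time derivative is rotated hyperbolically; an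
  event keeps the first component and sets the second one to 0. Postponing all events to the next
  point of a grid of width \<open>t/m\<close> turns the pair into a function of the independent increments of the
  Poisson process, whose mean satisfies a two-dimensional linear recursion. As \<open>m \<rightarrow> \<infinity>\<close> the
  postponed motion converges pathwise, dominated by \<open>exp (c t)\<close>, and the recursion converges to the
  solution of the differential equation.\<close>

section \<open>The hyperbolic distance\<close>

definition hyp_form :: "complex \<Rightarrow> complex \<Rightarrow> real" where
  "hyp_form z w = ((Re z - Re w)\<^sup>2 + (Im z)\<^sup>2 + (Im w)\<^sup>2) / (2 * Im z * Im w)"

lemma hyp_form_ge_1:
  assumes "0 < Im z" "0 < Im w"
  shows "1 \<le> hyp_form z w"
proof -
  have "2 * Im z * Im w \<le> (Im z)\<^sup>2 + (Im w)\<^sup>2"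
    by (rule sum_squares_bound)
  then have "2 * Im z * Im w \<le> (Re z - Re w)\<^sup>2 + (Im z)\<^sup>2 + (Im w)\<^sup>2"
    by (smt (verit) zero_le_power2)
  with assms show ?thesis
    by (simp add: hyp_form_def)
qed

lemma hyp_form_self:
  assumes "0 < Im z"
  shows "hyp_form z z = 1"
  using assms by (simp add: hyp_form_def power2_eq_square)

lemma hyp_form_gt_1:
  assumes "0 < Im z" "0 < Im w" "z \<noteq> w"
  shows "1 < hyp_form z w"
proof -
  have "0 < (Re z - Re w)\<^sup>2 + (Im z - Im w)\<^sup>2"
    using assms(3) by (simp add: complex_eq_iff sum_power2_gt_zero_iff)
  then have "2 * Im z * Im w < (Re z - Re w)\<^sup>2 + (Im z)\<^sup>2 + (Im w)\<^sup>2"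
    by (simp add: power2_diff)
  with assms show ?thesis
    by (simp add: hyp_form_def)
qed

lemma hyp_norm_eq:
  assumes "0 < Im z"
  shows "hyp_norm z v = cmod v / Im z"
  using assms
  by (simp add: hyp_norm_def hyp_inner_def real_sqrt_divide dot_square_norm)

lemma hyp_form_has_derivative:
  fixes \<gamma> :: "real \<Rightarrow> complex"
  assumes "0 < Im z" "0 < Im (\<gamma> s)" "(\<gamma> has_vector_derivative v) (at s)"
  shows "((\<lambda>s. hyp_form z (\<gamma> s)) has_real_derivative
    ((Re (\<gamma> s) - Re z) / (Im (\<gamma> s) * Im z) * Re v
     + ((Im (\<gamma> s))\<^sup>2 - (Re (\<gamma> s) - Re z)\<^sup>2 - (Im z)\<^sup>2) / (2 * (Im (\<gamma> s))\<^sup>2 * Im z) * Im v)) (at s)"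
proof -
  have [derivative_intros]: "((\<lambda>s. Re (\<gamma> s)) has_real_derivative Re v) (at s)"
    "((\<lambda>s. Im (\<gamma> s)) has_real_derivative Im v) (at s)"
    using assms(3) has_vector_derivative_complex_iff has_real_derivative_iff_has_vector_derivative by blast+
  show ?thesis
    unfolding hyp_form_def
    by (rule derivative_eq_intros refl | use assms in \<open>simp; fail\<close>)+
       (use assms in \<open>simp add: field_simps power2_eq_square\<close>)
qed

text \<open>The hyperbolic gradient of the form has norm \<open>sqrt (g\<^sup>2 - 1)\<close>; here \<open>p = Re v\<close>, \<open>q = Im v\<close>
  are the components of the direction.\<close>

lemma hyp_form_gradient_bound:
  assumes "0 < Im z" "0 < Im w"
  shows "((Re w - Re z) / (Im w * Im z) * p
     + ((Im w)\<^sup>2 - (Re w - Re z)\<^sup>2 - (Im z)\<^sup>2) / (2 * (Im w)\<^sup>2 * Im z) * q)\<^sup>2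
    \<le> ((hyp_form z w)\<^sup>2 - 1) * ((p\<^sup>2 + q\<^sup>2) / (Im w)\<^sup>2)"
proof -
  define A where "A = (Re w - Re z) / (Im w * Im z)"
  define B where "B = ((Im w)\<^sup>2 - (Re w - Re z)\<^sup>2 - (Im z)\<^sup>2) / (2 * (Im w)\<^sup>2 * Im z)"
  have "(A * p + B * q)\<^sup>2 + (A * q - B * p)\<^sup>2 = (A\<^sup>2 + B\<^sup>2) * (p\<^sup>2 + q\<^sup>2)"
    by algebra
  then have "(A * p + B * q)\<^sup>2 \<le> (A\<^sup>2 + B\<^sup>2) * (p\<^sup>2 + q\<^sup>2)"
    by (smt (verit) zero_le_power2)
  moreover have "A\<^sup>2 + B\<^sup>2 = ((hyp_form z w)\<^sup>2 - 1) / (Im w)\<^sup>2"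
    unfolding A_def B_def hyp_form_def using assms
    by (simp add: divide_simps) algebra
  ultimately show ?thesis
    by (simp add: A_def B_def)
qed

text \<open>The function \<open>arcosh (hyp_form z \<cdot>)\<close> is not smooth at \<open>z\<close>, so it is regularized by \<open>e > 0\<close>.\<close>

lemma hyp_length_ge:
  assumes "\<gamma> C1_differentiable_on {0..1}" "path_image \<gamma> \<subseteq> half_plane"
    and z: "pathstart \<gamma> = z" and w: "pathfinish \<gamma> = w"
  shows "arcosh (hyp_form z w) \<le> hyp_length \<gamma>"
proof -
  obtain D where D: "\<And>s. s \<in> {0..1} \<Longrightarrow> (\<gamma> has_vector_derivative D s) (at s)"
    and contD: "continuous_on {0..1} D"
    using assms(1) unfolding C1_differentiable_on_def by blast
  have pos: "0 < Im (\<gamma> s)" if "s \<in> {0..1}" for s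
    using that assms(2) unfolding path_image_def half_plane_def by (metis (lifting) image_subset_iff mem_Collect_eq)
  have zpos: "0 < Im z"
    using pos[of 0] z by (simp add: pathstart_def)
  have cont: "continuous_on {0..1} \<gamma>"
    by (meson D continuous_at_imp_continuous_on has_vector_derivative_continuous)
  have len: "hyp_length \<gamma> = integral {0..1} (\<lambda>s. cmod (D s) / Im (\<gamma> s))"
    unfolding hyp_length_def
    by (rule integral_cong) (simp add: hyp_norm_eq pos vector_derivative_at[OF D])
  have int: "(\<lambda>s. cmod (D s) / Im (\<gamma> s)) integrable_on {0..1}"
    by (intro integrable_continuous_interval continuous_intros contD cont)
       (use pos in force)
  define g where "g s = hyp_form z (\<gamma> s)" for s
  have g1: "1 \<le> g s" if "s \<in> {0..1}" for s
    unfolding g_def using hyp_form_ge_1 zpos pos that by blast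
  define g' where "g' s = (Re (\<gamma> s) - Re z) / (Im (\<gamma> s) * Im z) * Re (D s)
     + ((Im (\<gamma> s))\<^sup>2 - (Re (\<gamma> s) - Re z)\<^sup>2 - (Im z)\<^sup>2) / (2 * (Im (\<gamma> s))\<^sup>2 * Im z) * Im (D s)" for s
  have dg: "(g has_real_derivative g' s) (at s)" if "s \<in> {0..1}" for s
    unfolding g_def g'_def using hyp_form_has_derivative[OF zpos pos[OF that] D[OF that]] .
  have g'_le: "\<bar>g' s\<bar> \<le> sqrt ((g s)\<^sup>2 - 1) * (cmod (D s) / Im (\<gamma> s))" if "s \<in> {0..1}" for s
  proof -
    have "(g' s)\<^sup>2 \<le> ((g s)\<^sup>2 - 1) * ((cmod (D s))\<^sup>2 / (Im (\<gamma> s))\<^sup>2)"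
      unfolding g_def g'_def cmod_power2
      by (rule hyp_form_gradient_bound[OF zpos pos[OF that]])
    then have "sqrt ((g' s)\<^sup>2) \<le> sqrt (((g s)\<^sup>2 - 1) * ((cmod (D s))\<^sup>2 / (Im (\<gamma> s))\<^sup>2))"
      by (rule real_sqrt_le_mono)
    then show ?thesis
      using pos[OF that] by (simp add: real_sqrt_mult real_sqrt_divide)
  qed
  define f where "f e x = ln (x + sqrt (x\<^sup>2 - 1 + e))" for e x :: real
  have bound: "f e (g 1) - f e (g 0) \<le> hyp_length \<gamma>" if e: "0 < e" for e
  proof -
    have rpos: "0 < (g s)\<^sup>2 - 1 + e" if "s \<in> {0..1}" for s
      using g1[OF that] e one_le_power[of "g s" 2] by linarith
    have df: "((\<lambda>s. f e (g s)) has_real_derivative g' s / sqrt ((g s)\<^sup>2 - 1 + e)) (at s)"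
      if s: "s \<in> {0..1}" for s
    proof -
      define R where "R = sqrt ((g s)\<^sup>2 - 1 + e)"
      have R: "0 < R" using rpos[OF s] by (simp add: R_def)
      have nz: "0 < g s + R" using R g1[OF s] by linarith
      have "((\<lambda>s. (g s)\<^sup>2 - 1 + e) has_real_derivative 2 * g s * g' s) (at s)"
        by (auto intro!: derivative_eq_intros dg[OF s])
      from DERIV_chain2[OF DERIV_real_sqrt[OF rpos[OF s]] this]
      have dR: "((\<lambda>s. sqrt ((g s)\<^sup>2 - 1 + e)) has_real_derivative
          (2 * g s * g' s) * (inverse R / 2)) (at s)"
        by (simp add: R_def mult.commute)
      have "((\<lambda>s. f e (g s)) has_real_derivative
          (g' s + (2 * g s * g' s) * (inverse R / 2)) / (g s + R)) (at s)"
        unfolding f_def using DERIV_chain2[OF DERIV_ln_divide DERIV_add[OF dg[OF s] dR]] nz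
        by (simp add: R_def)
      moreover have "(g' s + (2 * g s * g' s) * (inverse R / 2)) / (g s + R) = g' s / R"
        using R nz by (simp add: divide_simps) (simp add: algebra_simps)
      ultimately show ?thesis by (simp add: R_def)
    qed
    have "((\<lambda>s. g' s / sqrt ((g s)\<^sup>2 - 1 + e)) has_integral f e (g 1) - f e (g 0)) {0..1}"
      by (rule fundamental_theorem_of_calculus)
         (auto intro!: has_field_derivative_at_within df
               simp: has_real_derivative_iff_has_vector_derivative[symmetric])
    moreover have "((\<lambda>s. cmod (D s) / Im (\<gamma> s)) has_integral hyp_length \<gamma>) {0..1}"
      unfolding len using int by (rule integrable_integral)
    moreover have "g' s / sqrt ((g s)\<^sup>2 - 1 + e) \<le> cmod (D s) / Im (\<gamma> s)" if s: "s \<in> {0..1}" for s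
    proof -
      have "g' s \<le> sqrt ((g s)\<^sup>2 - 1) * (cmod (D s) / Im (\<gamma> s))"
        using g'_le[OF s] by linarith
      also have "\<dots> \<le> sqrt ((g s)\<^sup>2 - 1 + e) * (cmod (D s) / Im (\<gamma> s))"
        using e pos[OF s] by (intro mult_right_mono) auto
      finally show ?thesis
        using rpos[OF s] by (simp add: divide_simps mult.commute)
    qed
    ultimately show ?thesis
      by (rule has_integral_le)
  qed
  have g01: "g 0 = 1" "g 1 = hyp_form z w"
    using z w zpos by (simp_all add: g_def pathstart_def pathfinish_def hyp_form_self)
  have "((\<lambda>e. f e (g 1) - f e (g 0)) \<longlongrightarrow> f 0 (g 1) - f 0 (g 0)) (at_right 0)"
    unfolding f_def using g1[of 1] g01
    by (intro tendsto_intros) (auto simp: add_nonneg_eq_0_iff)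
  moreover have "\<forall>\<^sub>F e in at_right 0. f e (g 1) - f e (g 0) \<le> hyp_length \<gamma>"
    using eventually_at_right_less[of 0] by eventually_elim (rule bound)
  ultimately have "f 0 (g 1) - f 0 (g 0) \<le> hyp_length \<gamma>"
    by (intro tendsto_upperbound) auto
  then show ?thesis
    using g1[of 1] by (simp add: f_def g01 arcosh_real_def)
qed

lemma ex_minimal_curve:
  assumes z: "0 < Im z" and w: "0 < Im w"
  shows "\<exists>\<gamma>. \<gamma> C1_differentiable_on {0..1} \<and> path_image \<gamma> \<subseteq> half_plane \<and>
    pathstart \<gamma> = z \<and> pathfinish \<gamma> = w \<and> hyp_length \<gamma> = arcosh (hyp_form z w)"
proof (cases "z = w")
  case True
  have "(\<lambda>_::real. z) C1_differentiable_on {0..1}"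
    by simp
  moreover have "hyp_length (\<lambda>_. z) = 0"
    unfolding hyp_length_def hyp_norm_def hyp_inner_def by simp
  ultimately show ?thesis
    using True z hyp_form_self[OF z]
    by (intro exI[of _ "\<lambda>_. z"])
       (auto simp: path_image_def half_plane_def pathstart_def pathfinish_def)
next
  case False
  define d where "d = arcosh (hyp_form z w)"
  have g1: "1 < hyp_form z w" using hyp_form_gt_1[OF z w False] .
  have d: "0 < d" "cosh d = hyp_form z w"
    using g1 by (auto simp: d_def)
  then have S: "0 < sinh d" by simp
  define a where "a s = (sinh (d - d * s) / Im z + sinh (d * s) / Im w) / sinh d" for s
  define b where "b s = (sinh (d - d * s) * Re z / Im z + sinh (d * s) * Re w / Im w) / sinh d" for s
  define a' where "a' s = (- cosh (d - d * s) / Im z + cosh (d * s) / Im w) / sinh d" for s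
  define b' where "b' s = (- cosh (d - d * s) * Re z / Im z + cosh (d * s) * Re w / Im w) / sinh d" for s
  define \<gamma> where "\<gamma> s = Complex (b s / a s) (1 / a s)" for s
  define \<gamma>' where "\<gamma>' s = Complex (d * (b' s * a s - b s * a' s) / (a s)\<^sup>2) (- d * a' s / (a s)\<^sup>2)" for s
  have apos: "0 < a s" if "s \<in> {0..1}" for s
  proof -
    have "0 \<le> sinh (d - d * s)" "0 \<le> sinh (d * s)"
      using that d mult_left_mono[of s 1 d] by auto
    moreover have "0 < sinh (d - d * s) \<or> 0 < sinh (d * s)"
      using that d mult_strict_left_mono[of s 1 d] by (cases "s = 0") auto
    ultimately have "0 < sinh (d - d * s) / Im z + sinh (d * s) / Im w"
      using z w by (auto intro: add_pos_nonneg add_nonneg_pos)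
    then show ?thesis using S by (simp add: a_def)
  qed
  have da: "(a has_real_derivative d * a' s) (at s)" for s
    unfolding a_def a'_def using z w S
    by (auto intro!: derivative_eq_intros simp: field_simps)
  have db: "(b has_real_derivative d * b' s) (at s)" for s
    unfolding b_def b'_def using z w S
    by (auto intro!: derivative_eq_intros simp: field_simps)
  have d\<gamma>: "(\<gamma> has_vector_derivative \<gamma>' s) (at s)" if s: "s \<in> {0..1}" for s
  proof -
    have nz: "a s \<noteq> 0" using apos[OF s] by simp
    have "((\<lambda>s. b s / a s) has_real_derivative d * (b' s * a s - b s * a' s) / (a s)\<^sup>2) (at s)"
      using nz by (auto intro!: derivative_eq_intros da db simp: field_simps power2_eq_square)
    moreover have "((\<lambda>s. 1 / a s) has_real_derivative - d * a' s / (a s)\<^sup>2) (at s)"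
      using nz by (auto intro!: derivative_eq_intros da simp: field_simps power2_eq_square)
    ultimately show ?thesis
      unfolding has_vector_derivative_complex_iff \<gamma>_def \<gamma>'_def
      by (simp add: has_real_derivative_iff_has_vector_derivative)
  qed
  have "continuous_on {0..1} \<gamma>'"
    unfolding \<gamma>'_def Complex_eq
    by (intro continuous_intros)
       (use apos z w S in \<open>force simp: a_def b_def a'_def b'_def intro!: continuous_intros\<close>)+
  with d\<gamma> have C1: "\<gamma> C1_differentiable_on {0..1}"
    unfolding C1_differentiable_on_def by blast
  have speed: "hyp_norm (\<gamma> s) (\<gamma>' s) = d" if s: "s \<in> {0..1}" for s
  proof -
    define W where "W = b' s * a s - b s * a' s"
    have "sinh (d - d * s) * cosh (d * s) + cosh (d - d * s) * sinh (d * s) = sinh d"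
      using sinh_add[of "d - d * s" "d * s"] by simp
    moreover have "W = (Re w - Re z) / (Im z * Im w) *
        (sinh (d - d * s) * cosh (d * s) + cosh (d - d * s) * sinh (d * s)) / (sinh d)\<^sup>2"
      unfolding W_def a_def b_def a'_def b'_def using z w S
      by (simp add: divide_simps) algebra
    ultimately have W: "W = (Re w - Re z) / (Im z * Im w * sinh d)"
      using S by (simp add: power2_eq_square)
    have "cosh (d - d * s) * cosh (d * s) + sinh (d - d * s) * sinh (d * s) = hyp_form z w"
      using cosh_add[of "d - d * s" "d * s"] d(2) by simp
    moreover have "(a s)\<^sup>2 - (a' s)\<^sup>2 = (((sinh (d - d * s))\<^sup>2 - (cosh (d - d * s))\<^sup>2) / (Im z)\<^sup>2
        + ((sinh (d * s))\<^sup>2 - (cosh (d * s))\<^sup>2) / (Im w)\<^sup>2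
        + 2 * (cosh (d - d * s) * cosh (d * s) + sinh (d - d * s) * sinh (d * s)) / (Im z * Im w))
        / (sinh d)\<^sup>2"
      unfolding a_def a'_def using z w S
      by (simp add: divide_simps) algebra
    ultimately have "(a s)\<^sup>2 - (a' s)\<^sup>2
        = (- 1 / (Im z)\<^sup>2 - 1 / (Im w)\<^sup>2 + 2 * hyp_form z w / (Im z * Im w)) / (sinh d)\<^sup>2"
      by (simp add: sinh_square_eq)
    also have "\<dots> = W\<^sup>2"
      unfolding W hyp_form_def using z w S
      by (simp add: divide_simps) algebra
    finally have key: "W\<^sup>2 + (a' s)\<^sup>2 = (a s)\<^sup>2" by simp
    have "(cmod (\<gamma>' s))\<^sup>2 = d\<^sup>2 * (W\<^sup>2 + (a' s)\<^sup>2) / (a s) ^ 4"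
      by (simp add: \<gamma>'_def cmod_power2 W_def[symmetric] power_divide power_mult_distrib
          add_divide_distrib distrib_left flip: power_mult)
    also have "\<dots> = (d / a s)\<^sup>2"
      unfolding key using apos[OF s] by (simp add: field_simps eval_nat_numeral)
    finally have "cmod (\<gamma>' s) = d / a s"
      using apos[OF s] d(1) by (simp add: power2_eq_iff_nonneg)
    then show ?thesis
      using apos[OF s] by (simp add: hyp_norm_eq \<gamma>_def)
  qed
  have "hyp_length \<gamma> = integral {0..1} (\<lambda>_::real. d)"
    unfolding hyp_length_def
    by (rule integral_cong) (simp add: vector_derivative_at[OF d\<gamma>] speed)
  then have "hyp_length \<gamma> = d" by simp
  moreover have "path_image \<gamma> \<subseteq> half_plane"
    using apos by (auto simp: path_image_def half_plane_def \<gamma>_def)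
  moreover have "pathstart \<gamma> = z" "pathfinish \<gamma> = w"
    using z w S by (auto simp: pathstart_def pathfinish_def \<gamma>_def a_def b_def complex_eq_iff)
  ultimately show ?thesis
    using C1 d_def by blast
qed

lemma hyp_dist_eq:
  assumes "0 < Im z" "0 < Im w"
  shows "hyp_dist z w = arcosh (hyp_form z w)"
  unfolding hyp_dist_def
proof (rule cInf_eq_minimum)
  show "arcosh (hyp_form z w) \<in> {hyp_length \<gamma> | \<gamma>. \<gamma> C1_differentiable_on {0..1} \<and>
     path_image \<gamma> \<subseteq> half_plane \<and> pathstart \<gamma> = z \<and> pathfinish \<gamma> = w}"
    using ex_minimal_curve[OF assms] by force
qed (auto intro: hyp_length_ge)

lemma cosh_hyp_dist:
  assumes "0 < Im z" "0 < Im w"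
  shows "cosh (hyp_dist z w) = hyp_form z w"
  using assms by (simp add: hyp_dist_eq hyp_form_ge_1)

section \<open>Geodesic lines\<close>

lemma geodesic_line_Im_pos: "geodesic_line \<gamma> \<Longrightarrow> 0 < Im (\<gamma> s)"
  by (auto simp: geodesic_line_def half_plane_def)

lemma geodesic_line_hyp_form:
  assumes "geodesic_line \<gamma>"
  shows "hyp_form (\<gamma> s) (\<gamma> t) = cosh (s - t)"
  using assms geodesic_line_Im_pos[OF assms] cosh_hyp_dist[of "\<gamma> s" "\<gamma> t"]
  by (simp add: geodesic_line_def)

text \<open>In the hyperboloid coordinates \<open>(1/y, x/y, (x\<^sup>2 + y\<^sup>2)/y)\<close> the form becomes a Lorentzian
  inner product, and a null vector orthogonal to a timelike one vanishes.\<close>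

lemma null_vector_eq_0:
  fixes a b e u1 u2 u3 :: real
  assumes "a * e - b\<^sup>2 = 1" "0 < a" "u1 * u3 = u2\<^sup>2" "u1 * e + u3 * a = 2 * u2 * b"
  shows "u1 = 0" "u2 = 0" "u3 = 0"
proof -
  have "0 < a * e" using assms(1) by (smt (verit) zero_le_power2)
  with assms(2) have e: "0 < e" by (simp add: zero_less_mult_iff)
  have "(u1 * e - u3 * a)\<^sup>2 + 4 * u2\<^sup>2 = 0"
    using assms(1,3,4) by algebra
  then have *: "u2 = 0" "u1 * e = u3 * a"
    by (smt (verit) zero_le_power2 power2_less_eq_zero_iff zero_eq_power2)+
  then have "u1 * e = 0" "u3 * a = 0" using assms(4) by auto
  with * e assms(2) show "u1 = 0" "u2 = 0" "u3 = 0" by auto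
qed

lemma hyp_form_coordinates:
  assumes "0 < Im z" "0 < Im w"
  shows "2 * hyp_form z w = 1 / Im z * (((Re w)\<^sup>2 + (Im w)\<^sup>2) / Im w)
    + ((Re z)\<^sup>2 + (Im z)\<^sup>2) / Im z * (1 / Im w) - 2 * (Re z / Im z) * (Re w / Im w)"
  using assms unfolding hyp_form_def
  by (simp add: divide_simps) algebra

lemma geodesic_line_interpolation:
  assumes \<gamma>: "geodesic_line \<gamma>" and z: "0 < Im z"
  shows "sinh 1 * hyp_form z (\<gamma> s)
    = sinh (1 - s) * hyp_form z (\<gamma> 0) + sinh s * hyp_form z (\<gamma> 1)"
proof -
  define F1 where "F1 w = 1 / Im w" for w
  define F2 where "F2 w = Re w / Im w" for w
  define F3 where "F3 w = ((Re w)\<^sup>2 + (Im w)\<^sup>2) / Im w" for w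
  have form: "2 * hyp_form v w = F1 v * F3 w + F3 v * F1 w - 2 * F2 v * F2 w"
    if "0 < Im v" "0 < Im w" for v w
    using hyp_form_coordinates[OF that] by (simp add: F1_def F2_def F3_def)
  define U where "U f = sinh 1 * f (\<gamma> s) - sinh (1 - s) * f (\<gamma> 0) - sinh s * f (\<gamma> 1)"
    for f :: "complex \<Rightarrow> real"
  have lin: "2 * (sinh 1 * hyp_form v (\<gamma> s) - sinh (1 - s) * hyp_form v (\<gamma> 0) - sinh s * hyp_form v (\<gamma> 1))
      = F1 v * U F3 + F3 v * U F1 - 2 * F2 v * U F2" if v: "0 < Im v" for v
    using form[OF v geodesic_line_Im_pos[OF \<gamma>, of s]] form[OF v geodesic_line_Im_pos[OF \<gamma>, of 0]]
      form[OF v geodesic_line_Im_pos[OF \<gamma>, of 1]]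
    unfolding U_def by algebra
  have orth: "F1 (\<gamma> r) * U F3 + F3 (\<gamma> r) * U F1 - 2 * F2 (\<gamma> r) * U F2 = 0" for r
  proof -
    have "sinh 1 * cosh (r - s) - sinh (1 - s) * cosh (r - 0) - sinh s * cosh (r - 1) = 0" for r :: real
      unfolding sinh_diff cosh_diff by (simp add: algebra_simps)
    then show ?thesis
      by (simp flip: lin[OF geodesic_line_Im_pos[OF \<gamma>]] add: geodesic_line_hyp_form[OF \<gamma>])
  qed
  have "U F1 * U F3 + U F3 * U F1 - 2 * U F2 * U F2
      = sinh 1 * (F1 (\<gamma> s) * U F3 + F3 (\<gamma> s) * U F1 - 2 * F2 (\<gamma> s) * U F2)
      - sinh (1 - s) * (F1 (\<gamma> 0) * U F3 + F3 (\<gamma> 0) * U F1 - 2 * F2 (\<gamma> 0) * U F2)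
      - sinh s * (F1 (\<gamma> 1) * U F3 + F3 (\<gamma> 1) * U F1 - 2 * F2 (\<gamma> 1) * U F2)"
    unfolding U_def by algebra
  then have null: "U F1 * U F3 = (U F2)\<^sup>2"
    unfolding orth by (simp add: power2_eq_square)
  have "F1 (\<gamma> 0) * F3 (\<gamma> 0) - (F2 (\<gamma> 0))\<^sup>2 = 1" "0 < F1 (\<gamma> 0)"
    using geodesic_line_Im_pos[OF \<gamma>, of 0]
    by (auto simp: F1_def F2_def F3_def field_simps power2_eq_square)
  moreover have "U F1 * F3 (\<gamma> 0) + U F3 * F1 (\<gamma> 0) = 2 * U F2 * F2 (\<gamma> 0)"
    using orth[of 0] by (simp add: algebra_simps)
  ultimately have "U F1 = 0" "U F2 = 0" "U F3 = 0"
    using null_vector_eq_0 null by blast+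
  with lin[OF z] show ?thesis by simp
qed

lemma hyp_form_geodesic_line:
  assumes "geodesic_line \<gamma>" "0 < Im z"
  obtains C where "\<And>s. hyp_form z (\<gamma> s) = cosh s * hyp_form z (\<gamma> 0) + sinh s * C"
proof
  fix s
  show "hyp_form z (\<gamma> s) = cosh s * hyp_form z (\<gamma> 0)
      + sinh s * ((hyp_form z (\<gamma> 1) - cosh 1 * hyp_form z (\<gamma> 0)) / sinh 1)"
    using geodesic_line_interpolation[OF assms, of s]
    by (simp add: sinh_diff field_simps)
qed

text \<open>Moving back from \<open>\<sigma> r\<close> to \<open>\<sigma> 0\<close> expresses the distance to \<open>\<i>\<close> by the form and its gradient
  at \<open>P\<close>, whose derivative along \<open>\<gamma>\<close> is the vanishing inner product.\<close>

lemma orthogonal_geodesic_pythagoras: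
  assumes "orthogonal_geodesic P \<epsilon> \<gamma>"
  shows "cosh (hyp_dist \<i> (\<gamma> s)) = cosh (hyp_dist \<i> P) * cosh s"
proof -
  obtain \<sigma> r v w where \<gamma>: "geodesic_line \<gamma>" "\<gamma> 0 = P"
    and \<sigma>: "geodesic_line \<sigma>" "\<sigma> 0 = \<i>" "\<sigma> r = P"
    and dw: "(\<sigma> has_vector_derivative w) (at r)" and dv: "(\<gamma> has_vector_derivative v) (at 0)"
    and orth: "hyp_inner P w v = 0"
    using assms unfolding orthogonal_geodesic_def by blast
  have P: "0 < Im P" using geodesic_line_Im_pos[OF \<gamma>(1), of 0] \<gamma>(2) by simp
  define G where "G z = (Re P - Re z) / (Im P * Im z) * Re w
     + ((Im P)\<^sup>2 - (Re P - Re z)\<^sup>2 - (Im z)\<^sup>2) / (2 * (Im P)\<^sup>2 * Im z) * Im w" for z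
  have from_P: "hyp_form z \<i> = cosh r * hyp_form z P - sinh r * G z" if z: "0 < Im z" for z
  proof -
    obtain C where C: "\<And>s. hyp_form z (\<sigma> s) = cosh s * hyp_form z (\<sigma> 0) + sinh s * C"
      using hyp_form_geodesic_line[OF \<sigma>(1) z] by blast
    have "((\<lambda>s. hyp_form z (\<sigma> s)) has_real_derivative G z) (at r)"
      using hyp_form_has_derivative[OF z _ dw] P by (simp add: G_def \<sigma>(3))
    moreover have "((\<lambda>s. cosh s * hyp_form z (\<sigma> 0) + sinh s * C) has_real_derivative
        sinh r * hyp_form z (\<sigma> 0) + cosh r * C) (at r)"
      by (auto intro!: derivative_eq_intros)
    then have "((\<lambda>s. hyp_form z (\<sigma> s)) has_real_derivative
        sinh r * hyp_form z (\<sigma> 0) + cosh r * C) (at r)"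
      by (simp only: C[symmetric])
    ultimately have "G z = sinh r * hyp_form z \<i> + cosh r * C"
      using DERIV_unique \<sigma>(2) by metis
    moreover have "hyp_form z P = cosh r * hyp_form z \<i> + sinh r * C"
      using C[of r] \<sigma>(2,3) by simp
    ultimately show ?thesis
      using hyperbolic_pythagoras[of r] by algebra
  qed
  obtain C where C: "\<And>s. hyp_form \<i> (\<gamma> s) = cosh s * hyp_form \<i> (\<gamma> 0) + sinh s * C"
    using hyp_form_geodesic_line[OF \<gamma>(1), of "\<i>"] by auto
  have sym: "hyp_form x y = hyp_form y x" for x y
    by (simp add: hyp_form_def power2_commute algebra_simps)
  have "((\<lambda>s. cosh s * hyp_form \<i> (\<gamma> 0) + sinh s * C) has_real_derivative C) (at 0)"
    by (auto intro!: derivative_eq_intros)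
  then have dC: "((\<lambda>s. hyp_form \<i> (\<gamma> s)) has_real_derivative C) (at 0)"
    by (simp only: C[symmetric])
  have "hyp_form \<i> (\<gamma> s) = cosh r * cosh s - sinh r * G (\<gamma> s)" for s
    using from_P[OF geodesic_line_Im_pos[OF \<gamma>(1), of s]]
      geodesic_line_hyp_form[OF \<gamma>(1), of s 0] \<gamma>(2)
    by (simp add: sym)
  moreover have "((\<lambda>s. cosh r * cosh s - sinh r * G (\<gamma> s)) has_real_derivative
      - sinh r * (- hyp_inner P w v)) (at 0)"
  proof -
    have [derivative_intros]: "((\<lambda>s. Re (\<gamma> s)) has_real_derivative Re v) (at 0)"
      "((\<lambda>s. Im (\<gamma> s)) has_real_derivative Im v) (at 0)"
      using dv has_vector_derivative_complex_iff has_real_derivative_iff_has_vector_derivative by blast+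
    have "((\<lambda>s. G (\<gamma> s)) has_real_derivative - hyp_inner P w v) (at 0)"
      unfolding G_def
      by (rule derivative_eq_intros refl | use P \<gamma>(2) in \<open>simp; fail\<close>)+
         (use P \<gamma>(2) in \<open>simp add: hyp_inner_def inner_complex_def field_simps power2_eq_square\<close>)
    then show ?thesis
      by (auto intro!: derivative_eq_intros)
  qed
  ultimately have "C = 0"
    using DERIV_unique dC orth by auto
  then show ?thesis
    using C[of s] \<gamma>(2) P cosh_hyp_dist geodesic_line_Im_pos[OF \<gamma>(1), of s] by simp
qed

lemma trajectory_cosh_hyp_dist:
  assumes "trajectory c T \<epsilon> x" and less: "\<And>n. T n < T (Suc n)"
    and "t \<in> {T n..T (Suc n)}"
  shows "cosh (hyp_dist \<i> (x t)) = cosh (c * (t - T n)) * (\<Prod>k<n. cosh (c * (T (Suc k) - T k)))"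
proof -
  obtain \<gamma> where \<gamma>0: "geodesic_line (\<gamma> 0)" "\<gamma> 0 0 = \<i>"
    and orth: "\<And>n. 1 \<le> n \<Longrightarrow> orthogonal_geodesic (x (T n)) (\<epsilon> n) (\<gamma> n)"
    and x: "\<And>n t. t \<in> {T n..T (Suc n)} \<Longrightarrow> x t = \<gamma> n (c * (t - T n))"
    using assms(1) unfolding trajectory_def by blast
  show ?thesis
    using assms(3)
  proof (induction n arbitrary: t)
    case 0
    have "hyp_dist (\<gamma> 0 0) (\<gamma> 0 s) = \<bar>0 - s\<bar>" for s
      using \<gamma>0(1) unfolding geodesic_line_def by blast
    then show ?case
      using x[OF 0] \<gamma>0(2) by simp
  next
    case (Suc n)
    have "cosh (hyp_dist \<i> (x t)) = cosh (hyp_dist \<i> (x (T (Suc n)))) * cosh (c * (t - T (Suc n)))"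
      using orthogonal_geodesic_pythagoras[OF orth[of "Suc n"]] x[OF Suc.prems] by simp
    also have "cosh (hyp_dist \<i> (x (T (Suc n))))
        = cosh (c * (T (Suc n) - T n)) * (\<Prod>k<n. cosh (c * (T (Suc k) - T k)))"
      by (rule Suc.IH) (simp add: less less_imp_le)
    finally show ?case by simp
  qed
qed

section \<open>Events postponed to a grid\<close>

text \<open>\<open>\<nu> j\<close> counts the events in the \<open>j\<close>-th cell, \<open>a\<close> is the distance travelled in one cell.\<close>

primrec grid_state :: "real \<Rightarrow> (nat \<Rightarrow> nat) \<Rightarrow> nat \<Rightarrow> real \<times> real" where
  "grid_state a \<nu> 0 = (1, 0)"
| "grid_state a \<nu> (Suc j) =
    (fst (grid_state a \<nu> j) * cosh a + snd (grid_state a \<nu> j) * sinh a,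
     if \<nu> j = 0 then fst (grid_state a \<nu> j) * sinh a + snd (grid_state a \<nu> j) * cosh a else 0)"

lemma grid_state_bounds:
  assumes "0 \<le> a"
  shows "0 \<le> fst (grid_state a \<nu> j)" "0 \<le> snd (grid_state a \<nu> j)"
    "fst (grid_state a \<nu> j) + snd (grid_state a \<nu> j) \<le> exp (a * j)"
proof -
  have "0 \<le> fst (grid_state a \<nu> j) \<and> 0 \<le> snd (grid_state a \<nu> j) \<and>
    fst (grid_state a \<nu> j) + snd (grid_state a \<nu> j) \<le> exp (a * j)"
  proof (induction j)
    case (Suc j)
    define z s where "z = fst (grid_state a \<nu> j)" and "s = snd (grid_state a \<nu> j)"
    have IH: "0 \<le> z" "0 \<le> s" "z + s \<le> exp (a * j)"
      using Suc by (auto simp: z_def s_def)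
    have nonneg: "0 \<le> z * cosh a + s * sinh a" "0 \<le> z * sinh a + s * cosh a"
      using IH assms by (auto intro!: add_nonneg_nonneg mult_nonneg_nonneg)
    have "z * cosh a + s * sinh a + (z * sinh a + s * cosh a) = (z + s) * exp a"
      unfolding cosh_plus_sinh[symmetric] by algebra
    also have "\<dots> \<le> exp (a * j) * exp a"
      using IH(3) by (rule mult_right_mono) simp
    also have "\<dots> = exp (a * Suc j)"
      by (simp add: exp_add distrib_left)
    finally show ?case
      using nonneg by (auto simp flip: z_def s_def)
  qed simp
  then show "0 \<le> fst (grid_state a \<nu> j)" "0 \<le> snd (grid_state a \<nu> j)"
    "fst (grid_state a \<nu> j) + snd (grid_state a \<nu> j) \<le> exp (a * j)"
    by auto
qed

text \<open>\<open>N j\<close> counts the events up to grid point \<open>j\<close>, and \<open>r k\<close> is the grid point to which the \<open>k\<close>-th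
  event is postponed.\<close>

lemma grid_state_eq:
  fixes r N :: "nat \<Rightarrow> nat" and a :: real
  assumes "N 0 = 0" "r 0 = 0" and r: "\<And>k j. r k \<le> j \<longleftrightarrow> k \<le> N j"
  defines "P \<equiv> \<lambda>n. \<Prod>k<n. cosh (a * (real (r (Suc k)) - real (r k)))"
  shows "grid_state a (\<lambda>j. N (Suc j) - N j) j =
    (P (N j) * cosh (a * (real j - real (r (N j)))), P (N j) * sinh (a * (real j - real (r (N j)))))"
proof (induction j)
  case 0
  then show ?case using assms by simp
next
  case (Suc j)
  define x where "x = a * (real j - real (r (N j)))"
  have x: "a * (real (Suc j) - real (r (N j))) = x + a"
    by (simp add: x_def algebra_simps)
  have IH: "grid_state a (\<lambda>j. N (Suc j) - N j) j = (P (N j) * cosh x, P (N j) * sinh x)"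
    using Suc by (simp only: x_def)
  have mono: "N j \<le> N (Suc j)"
    using r le_SucI by blast
  show ?case
  proof (cases "N (Suc j) = N j")
    case True
    then show ?thesis
      unfolding grid_state.simps IH True x by (simp add: cosh_add sinh_add algebra_simps)
  next
    case False
    with mono have less: "N j < N (Suc j)" by simp
    have r_eq: "r k = Suc j" if "N j < k" "k \<le> N (Suc j)" for k
      using r[of k j] r[of k "Suc j"] that by simp
    have "P (N (Suc j)) = (\<Prod>k<Suc (N j). cosh (a * (real (r (Suc k)) - real (r k))))"
      unfolding P_def
      by (rule prod.mono_neutral_right) (use less in \<open>auto simp: r_eq\<close>)
    also have "\<dots> = P (N j) * cosh (x + a)"
      using r_eq[of "Suc (N j)"] less x by (simp add: P_def)
    finally show ?thesis
      unfolding grid_state.simps IH using less r_eq[of "N (Suc j)"]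
      by (simp add: cosh_add algebra_simps)
  qed
qed

lemma grid_round_tendsto:
  fixes t x :: real
  assumes "0 < t" "0 \<le> x"
  shows "(\<lambda>m. t / real (Suc m) * real (nat \<lceil>x / (t / real (Suc m))\<rceil>)) \<longlonglongrightarrow> x"
proof (rule tendsto_sandwich)
  have *: "x \<le> h * real (nat \<lceil>x / h\<rceil>)" "h * real (nat \<lceil>x / h\<rceil>) \<le> x + h" if "0 < h" for h
  proof -
    have "0 \<le> x / h" using that assms(2) by simp
    then have "0 \<le> \<lceil>x / h\<rceil>" by linarith
    then have "x / h \<le> real (nat \<lceil>x / h\<rceil>)" "real (nat \<lceil>x / h\<rceil>) \<le> x / h + 1"
      using of_int_ceiling_le_add_one[of "x / h"] le_of_int_ceiling[of "x / h"]
      by simp_all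
    then show "x \<le> h * real (nat \<lceil>x / h\<rceil>)" "h * real (nat \<lceil>x / h\<rceil>) \<le> x + h"
      using that by (simp_all add: field_simps)
  qed
  show "\<forall>\<^sub>F m in sequentially. x \<le> t / real (Suc m) * real (nat \<lceil>x / (t / real (Suc m))\<rceil>)"
    by (intro always_eventually allI *) (use assms(1) in simp)
  show "\<forall>\<^sub>F m in sequentially. t / real (Suc m) * real (nat \<lceil>x / (t / real (Suc m))\<rceil>) \<le> x + t / real (Suc m)"
    by (intro always_eventually allI *) (use assms(1) in simp)
  have "(\<lambda>m. x + t * inverse (real (Suc m))) \<longlonglongrightarrow> x + t * 0"
    by (intro tendsto_intros LIMSEQ_inverse_real_of_nat)
  then show "(\<lambda>m. x + t / real (Suc m)) \<longlonglongrightarrow> x"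
    by (simp add: divide_inverse)
qed simp

lemma le_card_event_iff:
  fixes T :: "nat \<Rightarrow> real"
  assumes "T 0 = 0" and less: "\<And>n. T n < T (Suc n)" and lim: "filterlim T at_top sequentially"
    and t: "0 \<le> t"
  shows "n \<le> card {n. 1 \<le> n \<and> T n \<le> t} \<longleftrightarrow> T n \<le> t"
proof -
  have mono: "strict_mono T"
    using less by (simp add: strict_mono_Suc_iff)
  define K where "K = (LEAST n. t < T n)"
  have "\<forall>\<^sub>F n in sequentially. t < T n"
    using lim unfolding filterlim_at_top_dense by blast
  then have "\<exists>n. t < T n"
    by (rule eventually_happens'[OF sequentially_bot])
  then have K: "t < T K"
    unfolding K_def by (rule LeastI_ex)
  have iff: "T n \<le> t \<longleftrightarrow> n < K" for n
  proof
    assume "T n \<le> t"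
    with K have "T n < T K" by simp
    then show "n < K" by (simp add: strict_mono_less[OF mono])
  next
    assume "n < K"
    then have "\<not> t < T n" unfolding K_def by (rule not_less_Least)
    then show "T n \<le> t" by simp
  qed
  have "0 < K" using iff[of 0] assms(1) t by simp
  have "{n. 1 \<le> n \<and> T n \<le> t} = {1..K - 1}"
    unfolding iff using \<open>0 < K\<close> by auto
  then have "card {n. 1 \<le> n \<and> T n \<le> t} = K - 1" by simp
  then show ?thesis
    using iff[of n] \<open>0 < K\<close> by linarith
qed

lemma grid_state_tendsto:
  fixes T :: "nat \<Rightarrow> real"
  assumes T: "T 0 = 0" "\<And>n. T n < T (Suc n)" "filterlim T at_top sequentially"
    and t: "0 < t" and n: "t \<in> {T n..<T (Suc n)}"
  defines "N \<equiv> \<lambda>t. card {n. 1 \<le> n \<and> T n \<le> t}"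
  shows "(\<lambda>m. fst (grid_state (c * (t / Suc m))
      (\<lambda>j. N (t / Suc m * Suc j) - N (t / Suc m * j)) (Suc m)))
    \<longlonglongrightarrow> cosh (c * (t - T n)) * (\<Prod>k<n. cosh (c * (T (Suc k) - T k)))"
proof -
  have N_iff: "k \<le> N s \<longleftrightarrow> T k \<le> s" if "0 \<le> s" for k s
    unfolding N_def using le_card_event_iff[OF T that] .
  have "N t = n"
    using N_iff[of t n] N_iff[of t "Suc n"] t n by (simp add: not_le)
  have T_nonneg: "0 \<le> T k" for k
    using lift_Suc_mono_le[of T 0 k, OF less_imp_le[OF T(2)]] T(1) by simp
  define h where "h m = t / real (Suc m)" for m
  have h: "0 < h m" for m using t by (simp add: h_def)
  define r where "r m k = nat \<lceil>T k / h m\<rceil>" for m k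
  have r: "r m k \<le> j \<longleftrightarrow> k \<le> N (h m * real j)" for m k j
    using h[of m] N_iff[of "h m * real j" k]
    by (simp add: r_def nat_le_iff ceiling_le_iff pos_divide_le_eq mult.commute)
  have "N 0 = 0"
    using N_iff[of 0 1] T(1) T(2)[of 0] by simp
  have eq: "fst (grid_state (c * h m) (\<lambda>j. N (h m * Suc j) - N (h m * j)) (Suc m))
    = (\<Prod>k<n. cosh (c * (h m * real (r m (Suc k)) - h m * real (r m k))))
      * cosh (c * (t - h m * real (r m n)))" for m
  proof -
    have hm: "h m * real (Suc m) = t" by (simp add: h_def)
    have "c * h m * (real (Suc m) - real (r m n)) = c * (h m * real (Suc m) - h m * real (r m n))"
      by (simp only: right_diff_distrib mult.assoc)
    moreover have "c * h m * (real (r m (Suc k)) - real (r m k))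
        = c * (h m * real (r m (Suc k)) - h m * real (r m k))" for k
      by (simp only: right_diff_distrib mult.assoc)
    moreover have "N (h m * real 0) = 0" "r m 0 = 0"
      using \<open>N 0 = 0\<close> T(1) by (simp_all add: r_def)
    ultimately show ?thesis
      using grid_state_eq[of "\<lambda>j. N (h m * real j)" "r m" "c * h m" "Suc m", OF _ _ r]
      by (simp only: hm \<open>N t = n\<close> fst_conv)
  qed
  have lim: "(\<lambda>m. h m * real (r m k)) \<longlonglongrightarrow> T k" for k
    unfolding h_def r_def using grid_round_tendsto[OF t T_nonneg] .
  have "(\<lambda>m. (\<Prod>k<n. cosh (c * (h m * real (r m (Suc k)) - h m * real (r m k))))
      * cosh (c * (t - h m * real (r m n))))
    \<longlonglongrightarrow> (\<Prod>k<n. cosh (c * (T (Suc k) - T k))) * cosh (c * (t - T n))"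
    by (intro tendsto_intros lim)
  then show ?thesis
    unfolding eq[symmetric] by (simp only: h_def mult.commute)
qed

section \<open>Means\<close>

text \<open>\<open>q\<close> is the probability of a cell without events.\<close>

primrec mean_state :: "real \<Rightarrow> real \<Rightarrow> real \<times> real \<Rightarrow> nat \<Rightarrow> real \<times> real" where
  "mean_state a q v 0 = v"
| "mean_state a q v (Suc j) =
    (fst (mean_state a q v j) * cosh a + snd (mean_state a q v j) * sinh a,
     q * (fst (mean_state a q v j) * sinh a + snd (mean_state a q v j) * cosh a))"

lemma mean_state_linear:
  "mean_state a q (x *\<^sub>R v + y *\<^sub>R w) j = x *\<^sub>R mean_state a q v j + y *\<^sub>R mean_state a q w j"
  by (induction j) (simp_all add: prod_eq_iff algebra_simps)

lemma mean_state_error: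
  fixes a q h b \<nu> :: real
  assumes a: "0 \<le> a" and q: "0 \<le> q" "q \<le> 1"
    and \<rho>: "\<bar>cosh a + \<nu> * sinh a - exp b\<bar> + \<bar>q * (sinh a + \<nu> * cosh a) - \<nu> * exp b\<bar> \<le> \<rho>"
  shows "\<bar>fst (mean_state a q (1, \<nu>) j) - exp (b * j)\<bar> + \<bar>snd (mean_state a q (1, \<nu>) j) - \<nu> * exp (b * j)\<bar>
    \<le> j * \<rho> * exp ((a + \<bar>b\<bar>) * j)"
proof (induction j)
  case (Suc j)
  define x y E K where "x = fst (mean_state a q (1, \<nu>) j)" and "y = snd (mean_state a q (1, \<nu>) j)"
    and "E = exp (b * j)" and "K = exp ((a + \<bar>b\<bar>) * j)"
  define dx dy where "dx = x - E" and "dy = y - \<nu> * E"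
  have IH: "\<bar>dx\<bar> + \<bar>dy\<bar> \<le> j * \<rho> * K"
    using Suc by (simp only: dx_def dy_def x_def y_def E_def K_def)
  have \<rho>0: "0 \<le> \<rho>" using \<rho> by linarith
  have E_Suc: "exp (b * Suc j) = E * exp b"
    by (simp add: E_def exp_add distrib_left)
  have EK: "E \<le> K"
    unfolding E_def K_def using a
    by (simp add: distrib_right) (smt (verit) mult_right_mono abs_ge_self of_nat_0_le_iff mult_nonneg_nonneg)
  have K_Suc: "K * exp a \<le> exp ((a + \<bar>b\<bar>) * Suc j)" "K \<le> exp ((a + \<bar>b\<bar>) * Suc j)"
    unfolding K_def using a by (simp_all add: distrib_left flip: exp_add)
  have "x * cosh a + y * sinh a - E * exp b
      = (dx * cosh a + dy * sinh a) + E * (cosh a + \<nu> * sinh a - exp b)"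
    by (simp add: dx_def dy_def algebra_simps)
  then have 1: "\<bar>x * cosh a + y * sinh a - E * exp b\<bar>
      \<le> \<bar>dx\<bar> * cosh a + \<bar>dy\<bar> * sinh a + E * \<bar>cosh a + \<nu> * sinh a - exp b\<bar>"
    using a by (simp only:) (rule order_trans[OF abs_triangle_ineq], rule add_mono,
        rule order_trans[OF abs_triangle_ineq], simp_all add: abs_mult E_def)
  have "q * (x * sinh a + y * cosh a) - \<nu> * (E * exp b)
      = q * (dx * sinh a + dy * cosh a) + E * (q * (sinh a + \<nu> * cosh a) - \<nu> * exp b)"
    by (simp add: dx_def dy_def algebra_simps)
  moreover have "\<bar>q * (dx * sinh a + dy * cosh a)\<bar> \<le> 1 * (\<bar>dx\<bar> * sinh a + \<bar>dy\<bar> * cosh a)"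
    unfolding abs_mult
    by (rule mult_mono) (use q a abs_triangle_ineq[of "dx * sinh a" "dy * cosh a"] in \<open>auto simp: abs_mult\<close>)
  ultimately have 2: "\<bar>q * (x * sinh a + y * cosh a) - \<nu> * (E * exp b)\<bar>
      \<le> \<bar>dx\<bar> * sinh a + \<bar>dy\<bar> * cosh a + E * \<bar>q * (sinh a + \<nu> * cosh a) - \<nu> * exp b\<bar>"
    by (simp only:) (rule order_trans[OF abs_triangle_ineq], rule add_mono, simp_all add: abs_mult E_def)
  have "\<bar>x * cosh a + y * sinh a - E * exp b\<bar> + \<bar>q * (x * sinh a + y * cosh a) - \<nu> * (E * exp b)\<bar>
      \<le> (\<bar>dx\<bar> + \<bar>dy\<bar>) * exp a + E * (\<bar>cosh a + \<nu> * sinh a - exp b\<bar> + \<bar>q * (sinh a + \<nu> * cosh a) - \<nu> * exp b\<bar>)"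
    using add_mono[OF 1 2] unfolding cosh_plus_sinh[symmetric] by (simp add: algebra_simps)
  also have "\<dots> \<le> (j * \<rho> * K) * exp a + K * \<rho>"
    using IH EK \<rho> \<rho>0 by (intro add_mono mult_mono mult_right_mono) (auto simp: K_def)
  also have "\<dots> = j * \<rho> * (K * exp a) + \<rho> * K" by (simp add: mult_ac)
  also have "\<dots> \<le> j * \<rho> * exp ((a + \<bar>b\<bar>) * Suc j) + \<rho> * exp ((a + \<bar>b\<bar>) * Suc j)"
    using \<rho>0 by (intro add_mono mult_left_mono K_Suc) auto
  also have "\<dots> = Suc j * \<rho> * exp ((a + \<bar>b\<bar>) * Suc j)"
    by (simp add: distrib_right)
  finally show ?case
    unfolding mean_state.simps fst_conv snd_conv E_Suc x_def[symmetric] y_def[symmetric] .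
qed simp

text \<open>For a root \<open>\<mu>\<close> of the characteristic polynomial, \<open>exp (\<mu> s)\<close> and \<open>\<mu>/c * exp (\<mu> s)\<close> satisfy
  the recursion up to an error \<open>o(h)\<close> in each of the \<open>t/h\<close> steps.\<close>

lemma mean_state_tendsto:
  fixes lam c t \<mu> :: real
  assumes "0 < lam" "0 < c" "0 < t" and \<mu>: "\<mu>\<^sup>2 + lam * \<mu> = c\<^sup>2"
  shows "(\<lambda>m. fst (mean_state (c * (t / Suc m)) (exp (- (lam * (t / Suc m)))) (1, \<mu> / c) (Suc m)))
    \<longlonglongrightarrow> exp (\<mu> * t)"
proof -
  define \<nu> where "\<nu> = \<mu> / c"
  define f where "f h = cosh (c * h) + \<nu> * sinh (c * h) - exp (\<mu> * h)" for h
  define g where "g h = exp (- (lam * h)) * (sinh (c * h) + \<nu> * cosh (c * h)) - \<nu> * exp (\<mu> * h)" for h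
  define h where "h m = t / real (Suc m)" for m
  have h: "0 < h m" "h m * real (Suc m) = t" for m
    using assms(3) by (simp_all add: h_def)
  have "h \<longlonglongrightarrow> 0"
    unfolding h_def divide_inverse using tendsto_mult_right_zero[OF LIMSEQ_inverse_real_of_nat] .
  then have h0: "filterlim h (at 0) sequentially"
    using h(1) by (auto simp: filterlim_at intro!: always_eventually) (metis less_irrefl)
  have "c * \<nu> = \<mu>" using assms(2) by (simp add: \<nu>_def)
  then have "c * (c - lam * \<nu> - \<nu> * \<mu>) = c\<^sup>2 - (\<mu>\<^sup>2 + lam * \<mu>)"
    using assms(2) by (simp add: \<nu>_def right_diff_distrib power2_eq_square)
  then have "c - lam * \<nu> - \<nu> * \<mu> = 0"
    using assms(2) \<mu> by simp
  moreover have "(g has_real_derivative c - lam * \<nu> - \<nu> * \<mu>) (at 0)"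
    unfolding g_def by (auto intro!: derivative_eq_intros)
  moreover have "g 0 = 0" by (simp add: g_def)
  ultimately have g: "((\<lambda>h. g h / h) \<longlongrightarrow> 0) (at 0)"
    by (simp add: DERIV_def)
  have "(f has_real_derivative 0) (at 0)"
    unfolding f_def using \<open>c * \<nu> = \<mu>\<close> by (auto intro!: derivative_eq_intros simp: mult.commute)
  moreover have "f 0 = 0" by (simp add: f_def)
  ultimately have f: "((\<lambda>h. f h / h) \<longlongrightarrow> 0) (at 0)"
    by (simp add: DERIV_def)
  define \<rho> where "\<rho> m = \<bar>f (h m)\<bar> + \<bar>g (h m)\<bar>" for m
  have "(\<lambda>m. t * (\<bar>f (h m) / h m\<bar> + \<bar>g (h m) / h m\<bar>) * exp ((c + \<bar>\<mu>\<bar>) * t)) \<longlonglongrightarrow>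
      t * (\<bar>0\<bar> + \<bar>0\<bar>) * exp ((c + \<bar>\<mu>\<bar>) * t)"
    by (intro tendsto_intros filterlim_compose[OF f h0] filterlim_compose[OF g h0])
  moreover have "t * (\<bar>f (h m) / h m\<bar> + \<bar>g (h m) / h m\<bar>) = real (Suc m) * \<rho> m" for m
    using h(1)[of m] unfolding \<rho>_def h(2)[of m, symmetric]
    by (simp add: field_simps)
  ultimately have lim: "(\<lambda>m. real (Suc m) * \<rho> m * exp ((c + \<bar>\<mu>\<bar>) * t)) \<longlonglongrightarrow> 0"
    by simp
  have "\<bar>fst (mean_state (c * h m) (exp (- (lam * h m))) (1, \<nu>) (Suc m)) - exp (\<mu> * t)\<bar>
      \<le> real (Suc m) * \<rho> m * exp ((c + \<bar>\<mu>\<bar>) * t)" for m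
  proof -
    have e1: "(c * h m + \<bar>\<mu> * h m\<bar>) * real (Suc m) = (c + \<bar>\<mu>\<bar>) * (h m * real (Suc m))"
      using h(1)[of m] by (simp add: abs_mult algebra_simps)
    have e2: "\<mu> * h m * real (Suc m) = \<mu> * (h m * real (Suc m))" by simp
    have "\<bar>fst (mean_state (c * h m) (exp (- (lam * h m))) (1, \<nu>) (Suc m)) - exp (\<mu> * h m * real (Suc m))\<bar>
        + \<bar>snd (mean_state (c * h m) (exp (- (lam * h m))) (1, \<nu>) (Suc m)) - \<nu> * exp (\<mu> * h m * real (Suc m))\<bar>
        \<le> real (Suc m) * \<rho> m * exp ((c * h m + \<bar>\<mu> * h m\<bar>) * real (Suc m))"
      by (rule mean_state_error) (use assms(1,2) h(1)[of m] in \<open>auto simp: \<rho>_def f_def g_def\<close>)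
    then show ?thesis
      unfolding e1 e2 h(2) by linarith
  qed
  then have "(\<lambda>m. fst (mean_state (c * h m) (exp (- (lam * h m))) (1, \<nu>) (Suc m)) - exp (\<mu> * t)) \<longlonglongrightarrow> 0"
    by (intro Lim_null_comparison[OF _ lim] always_eventually) (simp del: mean_state.simps)
  then show ?thesis
    unfolding h_def \<nu>_def by (rule LIM_zero_cancel)
qed

definition mean_cosh :: "real \<Rightarrow> real \<Rightarrow> real \<Rightarrow> real" where
  "mean_cosh lam c t = exp (- (lam * t / 2)) *
     (cosh (t * sqrt (lam\<^sup>2 + 4 * c\<^sup>2) / 2)
        + lam / sqrt (lam\<^sup>2 + 4 * c\<^sup>2) * sinh (t * sqrt (lam\<^sup>2 + 4 * c\<^sup>2) / 2))"

lemma mean_cosh_eq: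
  fixes lam c :: real
  defines "d \<equiv> sqrt (lam\<^sup>2 + 4 * c\<^sup>2)"
  assumes "0 < c"
  shows "mean_cosh lam c t = (1 + lam / d) / 2 * exp ((d - lam) / 2 * t) + (1 - lam / d) / 2 * exp ((- d - lam) / 2 * t)"
proof -
  have "exp ((d - lam) / 2 * t) = exp (- (lam * t / 2)) * exp (t * d / 2)"
    "exp ((- d - lam) / 2 * t) = exp (- (lam * t / 2)) * exp (- (t * d / 2))"
    by (simp_all add: field_simps flip: exp_add)
  then show ?thesis
    unfolding mean_cosh_def d_def[symmetric] cosh_def sinh_def
    by (simp add: algebra_simps add_divide_distrib diff_divide_distrib)
qed

lemma mean_state_tendsto_mean_cosh:
  fixes lam c t :: real
  assumes "0 < lam" "0 < c" "0 < t"
  shows "(\<lambda>m. fst (mean_state (c * (t / Suc m)) (exp (- (lam * (t / Suc m)))) (1, 0) (Suc m)))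
    \<longlonglongrightarrow> mean_cosh lam c t"
proof -
  define d where "d = sqrt (lam\<^sup>2 + 4 * c\<^sup>2)"
  have d: "0 < d" "d\<^sup>2 = lam\<^sup>2 + 4 * c\<^sup>2"
    using assms by (simp_all add: d_def add_pos_pos)
  have "((d - lam) / 2)\<^sup>2 + lam * ((d - lam) / 2) = c\<^sup>2" "((- d - lam) / 2)\<^sup>2 + lam * ((- d - lam) / 2) = c\<^sup>2"
    using d(2) by (simp_all add: field_simps power2_eq_square)
  note lims = this[THEN mean_state_tendsto[OF assms]]
  have "(1 :: real, 0) = ((1 + lam / d) / 2) *\<^sub>R (1, (d - lam) / 2 / c) + ((1 - lam / d) / 2) *\<^sub>R (1, (- d - lam) / 2 / c)"
    using d(1) assms(2) by (simp add: divide_simps) (simp add: algebra_simps)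
  then show ?thesis
    unfolding mean_cosh_eq[OF assms(2)] d_def[symmetric]
    by (simp only: mean_state_linear fst_add fst_scaleR real_scaleR_def)
       (intro tendsto_intros lims)
qed

lemma mean_cosh_derivatives:
  fixes lam c :: real
  assumes "0 < c"
  obtains f' where "\<And>t. (mean_cosh lam c has_real_derivative f' t) (at t)"
    and "\<And>t. (f' has_real_derivative - lam * f' t + c\<^sup>2 * mean_cosh lam c t) (at t)"
    and "f' 0 = 0"
proof -
  define d where "d = sqrt (lam\<^sup>2 + 4 * c\<^sup>2)"
  have d: "0 < d" "d\<^sup>2 = lam\<^sup>2 + 4 * c\<^sup>2"
    using assms by (simp_all add: d_def add_nonneg_pos)
  define A B p q where "A = (1 + lam / d) / 2" and "B = (1 - lam / d) / 2"
    and "p = (d - lam) / 2" and "q = (- d - lam) / 2"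
  have eq: "mean_cosh lam c = (\<lambda>t. A * exp (p * t) + B * exp (q * t))"
    using mean_cosh_eq[OF assms] by (simp add: fun_eq_iff d_def A_def B_def p_def q_def)
  have pq: "p\<^sup>2 = - lam * p + c\<^sup>2" "q\<^sup>2 = - lam * q + c\<^sup>2"
    using d(2) by (simp_all add: p_def q_def field_simps power2_eq_square)
  show thesis
  proof
    show "(mean_cosh lam c has_real_derivative A * p * exp (p * t) + B * q * exp (q * t)) (at t)" for t
      unfolding eq by (auto intro!: derivative_eq_intros)
    have "((\<lambda>t. A * p * exp (p * t) + B * q * exp (q * t)) has_real_derivative
        A * p\<^sup>2 * exp (p * t) + B * q\<^sup>2 * exp (q * t)) (at t)" for t
      by (auto intro!: derivative_eq_intros simp: power2_eq_square)
    then show "((\<lambda>t. A * p * exp (p * t) + B * q * exp (q * t)) has_real_derivative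
        - lam * (A * p * exp (p * t) + B * q * exp (q * t)) + c\<^sup>2 * mean_cosh lam c t) (at t)" for t
      unfolding eq
      by (rule DERIV_cong) (simp only: pq, algebra)
    show "A * p * exp (p * 0) + B * q * exp (q * 0) = 0"
      using d(1) by (simp add: A_def B_def p_def q_def field_simps)
  qed
qed

lemma grid_state_cong:
  assumes "\<And>i. i < j \<Longrightarrow> \<nu> i = \<nu>' i"
  shows "grid_state a \<nu> j = grid_state a \<nu>' j"
  using assms by (induction j) auto

lemma measurable_grid_state:
  assumes "\<And>i. i < j \<Longrightarrow> (\<lambda>x. \<nu> x i) \<in> measurable M (count_space UNIV)"
  shows "(\<lambda>x. fst (grid_state a (\<nu> x) j)) \<in> borel_measurable M"
    and "(\<lambda>x. snd (grid_state a (\<nu> x) j)) \<in> borel_measurable M"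
proof -
  have "(\<lambda>x. fst (grid_state a (\<nu> x) j)) \<in> borel_measurable M \<and>
    (\<lambda>x. snd (grid_state a (\<nu> x) j)) \<in> borel_measurable M"
    using assms
  proof (induction j)
    case (Suc j)
    then have [measurable]: "(\<lambda>x. fst (grid_state a (\<nu> x) j)) \<in> borel_measurable M"
      "(\<lambda>x. snd (grid_state a (\<nu> x) j)) \<in> borel_measurable M"
      "(\<lambda>x. \<nu> x j) \<in> measurable M (count_space UNIV)"
      by auto
    show ?case
      by simp
  qed simp
  then show "(\<lambda>x. fst (grid_state a (\<nu> x) j)) \<in> borel_measurable M"
    "(\<lambda>x. snd (grid_state a (\<nu> x) j)) \<in> borel_measurable M"
    by auto
qed

lemma (in prob_space) expectation_grid_state:
  fixes \<nu> :: "nat \<Rightarrow> 'a \<Rightarrow> nat"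
  assumes indep: "indep_vars (\<lambda>_. count_space UNIV) \<nu> UNIV"
    and q: "\<And>i. prob {\<omega> \<in> space M. \<nu> i \<omega> = 0} = q" and a: "0 \<le> a"
  shows "expectation (\<lambda>\<omega>. fst (grid_state a (\<lambda>i. \<nu> i \<omega>) j)) = fst (mean_state a q (1, 0) j)"
    and "expectation (\<lambda>\<omega>. snd (grid_state a (\<lambda>i. \<nu> i \<omega>) j)) = snd (mean_state a q (1, 0) j)"
proof -
  have \<nu>[measurable]: "\<nu> i \<in> measurable M (count_space UNIV)" for i
    using indep by (auto simp: indep_vars_def)
  have meas[measurable]: "(\<lambda>\<omega>. fst (grid_state a (\<lambda>i. \<nu> i \<omega>) j)) \<in> borel_measurable M"
    "(\<lambda>\<omega>. snd (grid_state a (\<lambda>i. \<nu> i \<omega>) j)) \<in> borel_measurable M" for j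
    using measurable_grid_state[where \<nu> = "\<lambda>\<omega> i. \<nu> i \<omega>"] \<nu> by auto
  have int: "integrable M (\<lambda>\<omega>. fst (grid_state a (\<lambda>i. \<nu> i \<omega>) j))"
    "integrable M (\<lambda>\<omega>. snd (grid_state a (\<lambda>i. \<nu> i \<omega>) j))" for j
  proof -
    have "norm (fst (grid_state a x j)) \<le> exp (a * j)" "norm (snd (grid_state a x j)) \<le> exp (a * j)" for x
      using grid_state_bounds[OF a, of x j] by auto
    then show "integrable M (\<lambda>\<omega>. fst (grid_state a (\<lambda>i. \<nu> i \<omega>) j))"
      "integrable M (\<lambda>\<omega>. snd (grid_state a (\<lambda>i. \<nu> i \<omega>) j))"
      by (intro integrable_const_bound[where B = "exp (a * j)"] meas AE_I2; blast)+
  qed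
  have step: "expectation (\<lambda>\<omega>. indicator {0} (\<nu> j \<omega>) * F (grid_state a (\<lambda>i. \<nu> i \<omega>) j))
      = q * expectation (\<lambda>\<omega>. F (grid_state a (\<lambda>i. \<nu> i \<omega>) j))"
    if F: "F = (\<lambda>v. fst v * sinh a + snd v * cosh a)" for j and F :: "real \<times> real \<Rightarrow> real"
  proof -
    let ?P = "PiM {..<j} (\<lambda>_. count_space UNIV) :: (nat \<Rightarrow> nat) measure"
    let ?Q = "PiM {j} (\<lambda>_. count_space UNIV) :: (nat \<Rightarrow> nat) measure"
    have "indep_var ?Q (\<lambda>\<omega>. restrict (\<lambda>i. \<nu> i \<omega>) {j}) ?P (\<lambda>\<omega>. restrict (\<lambda>i. \<nu> i \<omega>) {..<j})"
      by (rule indep_var_restrict[OF indep]) auto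
    moreover have "(\<lambda>x. indicator {0} (x j) :: real) \<in> borel_measurable ?Q"
      by (rule measurable_compose[OF measurable_component_singleton]) auto
    moreover have [measurable]: "(\<lambda>x. fst (grid_state a x j)) \<in> borel_measurable ?P"
        "(\<lambda>x. snd (grid_state a x j)) \<in> borel_measurable ?P"
      by (rule measurable_grid_state; measurable)+
    then have "(\<lambda>x. F (grid_state a x j)) \<in> borel_measurable ?P"
      unfolding F by measurable
    ultimately have "indep_var borel ((\<lambda>x. indicator {0} (x j) :: real) \<circ> (\<lambda>\<omega>. restrict (\<lambda>i. \<nu> i \<omega>) {j}))
        borel ((\<lambda>x. F (grid_state a x j)) \<circ> (\<lambda>\<omega>. restrict (\<lambda>i. \<nu> i \<omega>) {..<j}))"
      by (rule indep_var_compose)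
    moreover have "(\<lambda>x. F (grid_state a x j)) \<circ> (\<lambda>\<omega>. restrict (\<lambda>i. \<nu> i \<omega>) {..<j})
        = (\<lambda>\<omega>. F (grid_state a (\<lambda>i. \<nu> i \<omega>) j))"
      by (auto simp: fun_eq_iff intro!: arg_cong[of _ _ F] grid_state_cong)
    moreover have "(\<lambda>x. indicator {0} (x j) :: real) \<circ> (\<lambda>\<omega>. restrict (\<lambda>i. \<nu> i \<omega>) {j})
        = (\<lambda>\<omega>. indicator {0} (\<nu> j \<omega>))"
      by auto
    ultimately have "indep_var borel (\<lambda>\<omega>. indicator {0} (\<nu> j \<omega>) :: real)
        borel (\<lambda>\<omega>. F (grid_state a (\<lambda>i. \<nu> i \<omega>) j))"
      by simp
    moreover have "integrable M (\<lambda>\<omega>. F (grid_state a (\<lambda>i. \<nu> i \<omega>) j))"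
      unfolding F using int by auto
    moreover have ind: "(\<lambda>\<omega>. indicator {0} (\<nu> j \<omega>) :: real) = indicator {\<omega>. \<nu> j \<omega> = 0}"
      by (auto simp: fun_eq_iff indicator_def)
    have "integrable M (\<lambda>\<omega>. indicator {0} (\<nu> j \<omega>) :: real)"
      by (rule integrable_const_bound[where B = 1]) (auto simp: indicator_def)
    ultimately have "expectation (\<lambda>\<omega>. indicator {0} (\<nu> j \<omega>) * F (grid_state a (\<lambda>i. \<nu> i \<omega>) j))
      = expectation (\<lambda>\<omega>. indicator {0} (\<nu> j \<omega>)) * expectation (\<lambda>\<omega>. F (grid_state a (\<lambda>i. \<nu> i \<omega>) j))"
      by (intro indep_var_lebesgue_integral)
    also have "expectation (\<lambda>\<omega>. indicator {0} (\<nu> j \<omega>)) = q"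
      unfolding ind q[of j, symmetric] by (simp add: Int_def conj_commute)
    finally show ?thesis .
  qed
  have "expectation (\<lambda>\<omega>. fst (grid_state a (\<lambda>i. \<nu> i \<omega>) j)) = fst (mean_state a q (1, 0) j) \<and>
    expectation (\<lambda>\<omega>. snd (grid_state a (\<lambda>i. \<nu> i \<omega>) j)) = snd (mean_state a q (1, 0) j)"
  proof (induction j)
    case 0
    then show ?case by (simp add: prob_space)
  next
    case (Suc j)
    have snd_eq: "snd (grid_state a x (Suc j))
        = indicator {0} (x j) * (fst (grid_state a x j) * sinh a + snd (grid_state a x j) * cosh a)" for x
      by (simp add: indicator_def)
    have "expectation (\<lambda>\<omega>. fst (grid_state a (\<lambda>i. \<nu> i \<omega>) (Suc j))) = fst (mean_state a q (1, 0) (Suc j))"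
      using Suc int by simp
    moreover have "expectation (\<lambda>\<omega>. snd (grid_state a (\<lambda>i. \<nu> i \<omega>) (Suc j))) = snd (mean_state a q (1, 0) (Suc j))"
      unfolding snd_eq step[OF refl] using Suc int by simp
    ultimately show ?case ..
  qed
  then show "expectation (\<lambda>\<omega>. fst (grid_state a (\<lambda>i. \<nu> i \<omega>) j)) = fst (mean_state a q (1, 0) j)"
    "expectation (\<lambda>\<omega>. snd (grid_state a (\<lambda>i. \<nu> i \<omega>) j)) = snd (mean_state a q (1, 0) j)"
    by auto
qed

context half_plane_motion
begin

lemma event_times:
  assumes "\<omega> \<in> space M"
  shows "T 0 \<omega> = 0" "\<And>n. T n \<omega> < T (Suc n) \<omega>" "filterlim (\<lambda>n. T n \<omega>) at_top sequentially"
  using assms T_0 T_less T_unbounded by auto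

lemma cosh_hyp_dist_tendsto:
  assumes \<omega>: "\<omega> \<in> space M" and t: "0 < t"
  shows "(\<lambda>m. fst (grid_state (c * (t / Suc m))
      (\<lambda>j. event_count T (t / Suc m * Suc j) \<omega> - event_count T (t / Suc m * j) \<omega>) (Suc m)))
    \<longlonglongrightarrow> cosh (hyp_dist \<i> (X t \<omega>))"
proof -
  define n where "n = event_count T t \<omega>"
  have iff: "k \<le> n \<longleftrightarrow> T k \<omega> \<le> t" for k
    unfolding n_def event_count_def
    using le_card_event_iff[OF event_times[OF \<omega>]] t by simp
  have n: "t \<in> {T n \<omega>..<T (Suc n) \<omega>}"
    using iff[of n] iff[of "Suc n"] by (simp add: not_le)
  then have "t \<in> {T n \<omega>..T (Suc n) \<omega>}" by simp
  note trajectory_cosh_hyp_dist[OF motion[OF \<omega>] event_times(2)[OF \<omega>] this]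
  with grid_state_tendsto[OF event_times[OF \<omega>] t n, of c] show ?thesis
    by (simp only: event_count_def)
qed

lemma prob_no_event:
  assumes "0 \<le> s" "s < t"
    and [measurable]: "(\<lambda>\<omega>. event_count T t \<omega> - event_count T s \<omega>) \<in> measurable M (count_space UNIV)"
  shows "prob {\<omega> \<in> space M. event_count T t \<omega> - event_count T s \<omega> = 0} = exp (- (rate * (t - s)))"
proof -
  have "prob {\<omega> \<in> space M. event_count T t \<omega> - event_count T s \<omega> = 0}
      = measure (distr M (count_space UNIV) (\<lambda>\<omega>. event_count T t \<omega> - event_count T s \<omega>)) {0}"
    by (subst measure_distr) (auto intro!: arg_cong[where f = prob])
  also have "\<dots> = pmf (poisson_pmf (rate * (t - s))) 0"
    unfolding poisson_increments[OF assms(1,2)] by (simp add: pmf.rep_eq)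
  also have "\<dots> = exp (- (rate * (t - s)))"
    using rate_pos assms by simp
  finally show ?thesis .
qed

lemma cosh_hyp_dist_integral:
  assumes t: "0 \<le> t"
  shows "integrable M (\<lambda>\<omega>. cosh (hyp_dist \<i> (X t \<omega>)))"
    and "expectation (\<lambda>\<omega>. cosh (hyp_dist \<i> (X t \<omega>))) = mean_cosh rate c t"
proof -
  have "integrable M (\<lambda>\<omega>. cosh (hyp_dist \<i> (X t \<omega>))) \<and>
    expectation (\<lambda>\<omega>. cosh (hyp_dist \<i> (X t \<omega>))) = mean_cosh rate c t"
  proof (cases "t = 0")
    case True
    have "cosh (hyp_dist \<i> (X t \<omega>)) = 1" if \<omega>: "\<omega> \<in> space M" for \<omega>
      using trajectory_cosh_hyp_dist[OF motion[OF \<omega>] event_times(2)[OF \<omega>], of t 0]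
        event_times(1,2)[OF \<omega>] True by (simp add: less_imp_le) (metis less_imp_le)
    then show ?thesis
      by (simp add: True mean_cosh_def prob_space cong: Bochner_Integration.integrable_cong Bochner_Integration.integral_cong)
  next
    case False
    with t have t: "0 < t" by simp
    define h where "h m = t / real (Suc m)" for m
    have h: "0 < h m" "h m * real (Suc m) = t" for m
      using t by (simp_all add: h_def)
    define \<nu> where "\<nu> m j \<omega> = event_count T (h m * real (Suc j)) \<omega> - event_count T (h m * real j) \<omega>"
      for m j \<omega>
    define Z where "Z m \<omega> = fst (grid_state (c * h m) (\<lambda>j. \<nu> m j \<omega>) (Suc m))" for m \<omega>
    have indep: "indep_vars (\<lambda>_. count_space UNIV) (\<nu> m) UNIV" for m
      unfolding \<nu>_def
      by (rule independent_increments) (use h(1)[of m] in \<open>auto intro!: monoI mult_left_mono\<close>)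
    then have \<nu>[measurable]: "\<nu> m j \<in> measurable M (count_space UNIV)" for m j
      by (auto simp: indep_vars_def)
    have no_event: "prob {\<omega> \<in> space M. \<nu> m j \<omega> = 0} = exp (- (rate * h m))" for m j
    proof -
      have diff: "h m * real (Suc j) - h m * real j = h m" by (simp add: algebra_simps)
      have "0 \<le> h m * real j" "h m * real j < h m * real (Suc j)"
        using h(1)[of m] by simp_all
      from prob_no_event[OF this \<nu>[of m j, unfolded \<nu>_def[abs_def]]]
      show ?thesis
        unfolding \<nu>_def diff .
    qed
    have mean: "expectation (Z m) = fst (mean_state (c * h m) (exp (- (rate * h m))) (1, 0) (Suc m))" for m
      unfolding Z_def
      by (rule expectation_grid_state(1)[OF indep no_event]) (use speed_pos h(1)[of m] in simp)
    have [measurable]: "Z m \<in> borel_measurable M" for m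
      unfolding Z_def by (rule measurable_grid_state) measurable
    have lim: "(\<lambda>m. Z m \<omega>) \<longlonglongrightarrow> cosh (hyp_dist \<i> (X t \<omega>))" if "\<omega> \<in> space M" for \<omega>
      unfolding Z_def \<nu>_def h_def using cosh_hyp_dist_tendsto[OF that t] .
    then have meas[measurable]: "(\<lambda>\<omega>. cosh (hyp_dist \<i> (X t \<omega>))) \<in> borel_measurable M"
      by (rule borel_measurable_LIMSEQ_real) measurable
    have bound: "norm (Z m \<omega>) \<le> exp (c * t)" for m \<omega>
    proof -
      have eq: "c * h m * real (Suc m) = c * t" unfolding h(2)[of m, symmetric] by simp
      have "0 \<le> c * h m" using speed_pos h(1)[of m] by simp
      from grid_state_bounds[OF this, of "\<lambda>j. \<nu> m j \<omega>" "Suc m", unfolded eq]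
      show ?thesis
        unfolding Z_def real_norm_def by linarith
    qed
    have "(\<lambda>m. expectation (Z m)) \<longlonglongrightarrow> expectation (\<lambda>\<omega>. cosh (hyp_dist \<i> (X t \<omega>)))"
      by (rule integral_dominated_convergence[where w = "\<lambda>_. exp (c * t)"]) (use lim bound in auto)
    moreover have "(\<lambda>m. expectation (Z m)) \<longlonglongrightarrow> mean_cosh rate c t"
      unfolding mean h_def by (rule mean_state_tendsto_mean_cosh[OF rate_pos speed_pos t])
    ultimately have "expectation (\<lambda>\<omega>. cosh (hyp_dist \<i> (X t \<omega>))) = mean_cosh rate c t"
      by (rule LIMSEQ_unique)
    moreover have "integrable M (\<lambda>\<omega>. cosh (hyp_dist \<i> (X t \<omega>)))"
      by (rule integrable_dominated_convergence[where w = "\<lambda>_. exp (c * t)" and s = Z])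
         (use lim bound in auto)
    ultimately show ?thesis by blast
  qed
  then show "integrable M (\<lambda>\<omega>. cosh (hyp_dist \<i> (X t \<omega>)))"
    "expectation (\<lambda>\<omega>. cosh (hyp_dist \<i> (X t \<omega>))) = mean_cosh rate c t"
    by auto
qed

end

theorem theorem3p2:
  fixes M :: "'a measure" and lam c :: real
    and T D :: "nat \<Rightarrow> 'a \<Rightarrow> real" and X :: "real \<Rightarrow> 'a \<Rightarrow> complex"
    and \<eta> :: "real \<Rightarrow> 'a \<Rightarrow> real" and E :: "real \<Rightarrow> real"
  assumes "0 < lam" and "0 < c"
    and "half_plane_motion M lam T c D X"
  defines "\<eta> \<equiv> \<lambda>t \<omega>. hyp_dist \<i> (X t \<omega>)"
  defines "E \<equiv> \<lambda>t. \<integral>\<omega>. cosh (\<eta> t \<omega>) \<partial>M"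
  shows "(\<forall>t\<ge>0. integrable M (\<lambda>\<omega>. cosh (\<eta> t \<omega>))) \<and>
    (\<forall>t>0. E differentiable (at t) \<and>
       (deriv E has_real_derivative (- lam * deriv E t + c\<^sup>2 * E t)) (at t)) \<and>
    E 0 = 1 \<and> (E has_real_derivative 0) (at_right 0) \<and>
    (\<forall>t\<ge>0. E t = exp (- (lam * t / 2)) *
       (cosh (t * sqrt (lam\<^sup>2 + 4 * c\<^sup>2) / 2)
        + lam / sqrt (lam\<^sup>2 + 4 * c\<^sup>2) * sinh (t * sqrt (lam\<^sup>2 + 4 * c\<^sup>2) / 2)))"
proof -
  interpret half_plane_motion M lam T c D X by fact
  have int: "\<forall>t\<ge>0. integrable M (\<lambda>\<omega>. cosh (\<eta> t \<omega>))"
    unfolding \<eta>_def using cosh_hyp_dist_integral(1) by blast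
  have E: "E t = mean_cosh lam c t" if "0 \<le> t" for t
    unfolding E_def \<eta>_def using cosh_hyp_dist_integral(2)[OF that] .
  obtain f' where f': "\<And>t. (mean_cosh lam c has_real_derivative f' t) (at t)"
    and f'': "\<And>t. (f' has_real_derivative - lam * f' t + c\<^sup>2 * mean_cosh lam c t) (at t)"
    and "f' 0 = 0"
    using mean_cosh_derivatives[OF \<open>0 < c\<close>] by blast
  have dE: "(E has_real_derivative f' t) (at t)" if "0 < t" for t
    by (rule has_field_derivative_transform_within_open[OF f', of "{0<..}"]) (use that E in auto)
  then have deriv: "deriv E t = f' t" if "0 < t" for t
    using that by (simp add: DERIV_imp_deriv)
  have "(deriv E has_real_derivative - lam * deriv E t + c\<^sup>2 * E t) (at t)" if "0 < t" for t
    unfolding deriv[OF that] E[OF less_imp_le[OF that]]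
    by (rule has_field_derivative_transform_within_open[OF f'', of "{0<..}"]) (use that deriv in auto)
  moreover have "E differentiable (at t)" if "0 < t" for t
    using dE[OF that] real_differentiable_def by blast
  moreover have "E 0 = 1"
    using E[of 0] by (simp add: mean_cosh_def)
  moreover have "(E has_real_derivative 0) (at 0 within {0..})"
  proof (rule has_field_derivative_transform_within)
    show "(mean_cosh lam c has_real_derivative 0) (at 0 within {0..})"
      using f'[of 0] \<open>f' 0 = 0\<close> by (simp add: has_field_derivative_at_within)
  qed (use E in \<open>auto intro: zero_less_one\<close>)
  then have "(E has_real_derivative 0) (at_right 0)"
    by (rule DERIV_subset) auto
  ultimately show ?thesis
    using int E unfolding mean_cosh_def by blast
qed

end
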